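(* For a permutation $\sigma=\sigma_1\cdots\sigma_n$ of $\{1,\dots,n\}$ define $$W_1(\sigma)=\prod_{j=2}^n(-1)^{\chi(j\text{ is a double ascent})},\quad W_2(\sigma)=\prod_{j=2}^n 0^{\chi(j\text{ is a double ascent})}\Big(\tfrac12\Big)^{\chi(j\text{ is a peak})},\quad W_3(\sigma)=\prod_{j=2}^n\Big(\tfrac12\Big)^{\chi(j\text{ is not a peak})},$$ $$W_4(\sigma)=\prod_{p=1}^{n-1}\Big(\tfrac{1+i}{2}\Big)^{\chi(\sigma_p<\sigma_{p+1})}\Big(\tfrac{1-i}{2}\Big)^{\chi(\sigma_p>\sigma_{p+1})},$$ where $i$ is the imaginary unit and $0^0=1$. Then for every positive integer $n$, $$\sum_{\sigma\in\mathfrak S_n}W_2(\sigma)=\sum_{\sigma\in\mathfrak S_n}W_3(\sigma)=\sum_{\sigma\in\mathfrak S_n}W_4(\sigma)=E_n,$$ and $\sum_{\sigma\in\mathfrak S_n}W_1(\sigma)$ equals $E_n$ if $n$ is odd and $0$ if $n$ is even.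
   Context: $E_n$ are the Euler numbers, defined by $\tan(x)+\sec(x)=\sum_{n\ge0}E_nx^n/n!$. $\mathfrak S_n$ is the set of permutations of $\{1,\dots,n\}$. For $\sigma\in\mathfrak S_n$ use the convention $\sigma_0=\sigma_{n+1}=+\infty$. For a letter (value) $j=\sigma_p$: $j$ is a peak if $\sigma_{p-1}<\sigma_p>\sigma_{p+1}$; a valley if $\sigma_{p-1}>\sigma_p<\sigma_{p+1}$; a double ascent if $\sigma_{p-1}<\sigma_p<\sigma_{p+1}$; a double descent if $\sigma_{p-1}>\sigma_p>\sigma_{p+1}$. $\chi(P)$ is $1$ if $P$ holds and $0$ otherwise. *)

theory Defs
  imports
    Complex_Main
    "HOL-Library.Extended_Nat"
    "HOL-Computational_Algebra.Formal_Power_Series"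
    "HOL-Combinatorics.Permutations"
begin

(* fps_tan 1 is the power series of tan x, and inverse (fps_cos 1) that of sec x. *)
definition euler_number :: "nat \<Rightarrow> real" where
  "euler_number n = fact n * fps_nth (fps_tan 1 + inverse (fps_cos 1)) n"

(* A permutation s of {1..n} is a function with "s permutes {1..n}", read as the word
   s 1, ..., s n.  Positions 0 and n + 1 carry the letter infinity. *)
definition letter :: "nat \<Rightarrow> (nat \<Rightarrow> nat) \<Rightarrow> nat \<Rightarrow> enat" where
  "letter n s p = (if p \<in> {1..n} then enat (s p) else \<infinity>)"

(* In the following predicates, j is a letter (a value of s), not a position. *)
definition is_peak :: "nat \<Rightarrow> (nat \<Rightarrow> nat) \<Rightarrow> nat \<Rightarrow> bool" where
  "is_peak n s j \<longleftrightarrow>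
     (\<exists>p\<in>{1..n}. s p = j \<and> letter n s (p - 1) < letter n s p \<and> letter n s p > letter n s (p + 1))"

definition is_double_ascent :: "nat \<Rightarrow> (nat \<Rightarrow> nat) \<Rightarrow> nat \<Rightarrow> bool" where
  "is_double_ascent n s j \<longleftrightarrow>
     (\<exists>p\<in>{1..n}. s p = j \<and> letter n s (p - 1) < letter n s p \<and> letter n s p < letter n s (p + 1))"

definition chi :: "bool \<Rightarrow> nat" where
  "chi P = (if P then 1 else 0)"

definition W1 :: "nat \<Rightarrow> (nat \<Rightarrow> nat) \<Rightarrow> real" where
  "W1 n s = (\<Prod>j=2..n. (- 1) ^ chi (is_double_ascent n s j))"

definition W2 :: "nat \<Rightarrow> (nat \<Rightarrow> nat) \<Rightarrow> real" where
  "W2 n s = (\<Prod>j=2..n. 0 ^ chi (is_double_ascent n s j) * (1 / 2) ^ chi (is_peak n s j))"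

definition W3 :: "nat \<Rightarrow> (nat \<Rightarrow> nat) \<Rightarrow> real" where
  "W3 n s = (\<Prod>j=2..n. (1 / 2) ^ chi (\<not> is_peak n s j))"

definition W4 :: "nat \<Rightarrow> (nat \<Rightarrow> nat) \<Rightarrow> complex" where
  "W4 n s = (\<Prod>p=1..<n. ((1 + \<i>) / 2) ^ chi (s p < s (p + 1)) * ((1 - \<i>) / 2) ^ chi (s p > s (p + 1)))"

end

theory Submission
  imports Defs "HOL-Combinatorics.Multiset_Permutations"
begin

text \<open>
  Give every letter the weight v, a, b or c according to whether it is a valley, a peak, a double
  ascent or a double descent. Removing the largest letter splits a word into two words that are
  again surrounded by larger letters, so the exponential generating function z of the total weights
  satisfies z' = v + (b + c) z + a z^2, and y = z / v satisfies y' = 1 + (b + c) y + a v y^2.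
  Dividing by v removes the weight of the letter 1, which is always a valley.
  For W1 this gives y' = 1 + y^2, solved by tan, and for W2 and W3 it gives y' = 1 + y + y^2 / 2,
  solved by tan + sec - 1. The weight W4 fits in as well: charging each
  ascent or descent to its left letter gives v = b = (1 + i) / 2 and a = c = (1 - i) / 2, where the
  last letter contributes the extra factor v, since it is followed by infinity.
\<close>

unbundle fps_syntax

section \<open>Weights of words between two bounding letters\<close>

text \<open>The two flags passed to \<open>g\<close> say whether the left neighbour of the letter is smaller and whether
  its right neighbour is larger; \<open>l\<close> and \<open>r\<close> are the letters surrounding the word.\<close>

fun word_weight :: "(bool \<Rightarrow> bool \<Rightarrow> 'a::comm_monoid_mult) \<Rightarrow> 'b::linorder \<Rightarrow> 'b list \<Rightarrow> 'b \<Rightarrow> 'a" where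
  "word_weight g l [] r = 1"
| "word_weight g l (x # xs) r = g (l < x) (x < hd (xs @ [r])) * word_weight g x xs r"

text \<open>A factor depends only on a letter and its two neighbours, so cutting at \<open>m\<close>
  makes the two sides independent: \<open>m\<close> bounds \<open>us\<close> on the right and
  \<open>ws\<close> on the left.\<close>

lemma word_weight_append:
  "word_weight g l (us @ m # ws) r =
    word_weight g l us m * g (last (l # us) < m) (m < hd (ws @ [r])) * word_weight g m ws r"
proof (induction us arbitrary: l)
  case (Cons x xs)
  then show ?case by (cases xs) (simp_all add: mult.assoc)
qed simp

lemma word_weight_map_upt:
  assumes "a \<le> b"
  shows "word_weight g (f a) (map f [Suc a..<Suc b]) (f (Suc b)) =
    (\<Prod>p\<in>{Suc a..b}. g (f (p - 1) < f p) (f p < f (Suc p)))"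
  using assms
proof (induction a rule: inc_induct)
  case base
  then show ?case by simp
next
  case (step a)
  have "hd (map f [Suc (Suc a)..<Suc b] @ [f (Suc b)]) = f (Suc (Suc a))"
    using step.hyps by (cases "Suc a = b") (simp_all add: upt_conv_Cons del: upt_Suc)
  moreover have "{Suc a..b} = insert (Suc a) {Suc (Suc a)..b}"
    using step.hyps by auto
  moreover have "[Suc a..<Suc b] = Suc a # [Suc (Suc a)..<Suc b]"
    using step.hyps by (simp add: upt_conv_Cons del: upt_Suc)
  ultimately show ?case
    using step.IH by (simp del: upt_Suc)
qed

section \<open>The recurrence from splitting at the largest letter\<close>

lemma sum_Pow_card:
  fixes h :: "nat \<Rightarrow> 'a::semiring_1"
  assumes "finite A"
  shows "(\<Sum>X\<in>Pow A. h (card X)) = (\<Sum>k\<le>card A. of_nat (card A choose k) * h k)"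
proof -
  have "(\<Sum>X\<in>Pow A. h (card X)) = (\<Sum>k\<le>card A. \<Sum>X | X \<in> Pow A \<and> card X = k. h (card X))"
    by (rule sum.group [symmetric]) (use assms in \<open>auto intro: card_mono\<close>)
  also have "\<dots> = (\<Sum>k\<le>card A. of_nat (card A choose k) * h k)"
    by (intro sum.cong refl) (simp add: n_subsets [OF assms])
  finally show ?thesis .
qed

text \<open>An arrangement of \<open>A\<close> is determined by the set \<open>X\<close> of letters
  before \<open>m\<close>, an order of \<open>X\<close>, and an order of the remaining letters after
  \<open>m\<close>.\<close>

lemma sum_permutations_of_set_split:
  assumes "finite A" and "m \<in> A"
  shows "(\<Sum>xs\<in>permutations_of_set A. h xs) =
    (\<Sum>X\<in>Pow (A - {m}). \<Sum>us\<in>permutations_of_set X.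
       \<Sum>ws\<in>permutations_of_set (A - {m} - X). h (us @ m # ws))"
proof -
  let ?I = "SIGMA X:Pow (A - {m}). permutations_of_set X \<times> permutations_of_set (A - {m} - X)"
  let ?f = "\<lambda>(X, us, ws). us @ m # ws"
  have "bij_betw ?f ?I (permutations_of_set A)"
    unfolding bij_betw_def
  proof (intro conjI subset_antisym subsetI)
    have "X = X' \<and> us = us' \<and> ws = ws'"
      if "(X, us, ws) \<in> ?I" "(X', us', ws') \<in> ?I" "us @ m # ws = us' @ m # ws'" for X us ws X' us' ws'
    proof -
      have "set us = X" "set us' = X'" "m \<notin> set us" "m \<notin> set ws"
        using that(1,2) by (auto simp: permutations_of_set_def)
      then show ?thesis using that(3) by (auto simp: append_Cons_eq_iff)
    qed
    then show "inj_on ?f ?I" by (auto simp: inj_on_def)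
  next
    fix xs assume "xs \<in> ?f ` ?I"
    then show "xs \<in> permutations_of_set A"
      using assms(2) by (auto simp: permutations_of_set_def)
  next
    fix xs assume xs: "xs \<in> permutations_of_set A"
    then have "m \<in> set xs" using assms(2) by (simp add: permutations_of_set_def)
    then obtain us ws where eq: "xs = us @ m # ws" by (meson split_list)
    have "(set us, us, ws) \<in> ?I"
      using xs by (auto simp: permutations_of_set_def eq)
    then show "xs \<in> ?f ` ?I"
      unfolding eq by (rule rev_image_eqI) simp
  qed
  then have "(\<Sum>xs\<in>permutations_of_set A. h xs) = (\<Sum>z\<in>?I. h (?f z))"
    by (rule sum.reindex_bij_betw [symmetric])
  also have "\<dots> = (\<Sum>(X, z)\<in>?I. h (fst z @ m # snd z))"
    by (intro sum.cong) auto
  also have "\<dots> = (\<Sum>X\<in>Pow (A - {m}). \<Sum>us\<in>permutations_of_set X.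
       \<Sum>ws\<in>permutations_of_set (A - {m} - X). h (us @ m # ws))"
    using assms(1) by (subst sum.Sigma [symmetric]) (auto simp: sum.cartesian_product case_prod_beta)
  finally show ?thesis .
qed

text \<open>Induction on \<open>card A\<close>, splitting at the maximum. Since only comparisons
  matter, the bounds \<open>l\<close> and \<open>r\<close> may be any letters above
  \<open>A\<close>; keeping them arbitrary lets the induction hypothesis apply to both blocks, where
  the maximum becomes one of the bounds.\<close>

lemma sum_word_weight:
  fixes g :: "bool \<Rightarrow> bool \<Rightarrow> 'a::comm_semiring_1" and A :: "'b::linorder set"
  assumes f_0: "f 0 = 1"
    and f_Suc: "\<And>n. f (Suc n) =
      (\<Sum>k\<le>n. of_nat (n choose k) * (f k * g (k \<noteq> 0) (k = n) * f (n - k)))"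
    and "finite A" "\<And>x. x \<in> A \<Longrightarrow> x < l" "\<And>x. x \<in> A \<Longrightarrow> x < r"
  shows "(\<Sum>xs\<in>permutations_of_set A. word_weight g l xs r) = f (card A)"
  using assms(3-)
proof (induction "card A" arbitrary: A l r rule: less_induct)
  case less
  show ?case
  proof (cases "A = {}")
    case True
    then show ?thesis by (simp add: f_0)
  next
    case False
    define m where "m = Max A"
    define B where "B = A - {m}"
    have m: "m \<in> A" using less.prems(1) False by (simp add: m_def)
    have B: "finite B" "card A = Suc (card B)" "card B < card A"
      using less.prems(1) m card_Suc_Diff1[of A m] by (simp_all add: B_def)
    have lt_m: "x < m" if "x \<in> B" for x
      using that less.prems(1) Max_ge[of A x] by (auto simp: B_def m_def order.strict_iff_order)
    have sub: "X \<subseteq> B \<Longrightarrow> x \<in> X \<Longrightarrow> x < m \<and> x < l \<and> x < r" for X x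
      using lt_m less.prems(2,3) by (auto simp: B_def)
    have IH: "(\<Sum>xs\<in>permutations_of_set X. word_weight g l' xs r') = f (card X)"
      if "X \<subseteq> B" "l' \<in> {l, m}" "r' \<in> {r, m}" for X l' r'
    proof (rule less.hyps)
      show "card X < card A" using card_mono[OF B(1) that(1)] B(3) by simp
      show "finite X" using that(1) B(1) by (rule finite_subset)
    qed (use sub[OF that(1)] that(2,3) in auto)
    have middle: "word_weight g l (us @ m # ws) r =
        g (X \<noteq> {}) (X = B) * (word_weight g l us m * word_weight g m ws r)"
      if X: "X \<subseteq> B" and us: "us \<in> permutations_of_set X"
        and ws: "ws \<in> permutations_of_set (B - X)" for X us ws
    proof -
      have su: "set us = X" and sw: "set ws = B - X"
        using us ws by (simp_all add: permutations_of_set_def)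
      have "m < l" "m < r" using less.prems(2,3) m by auto
      \<comment> \<open>The left neighbour of \<open>m\<close> is the larger bound \<open>l\<close>
        exactly when nothing precedes \<open>m\<close>; dually, its right neighbour is
        \<open>r\<close> exactly when all other letters precede it.\<close>
      have "(last (l # us) < m) = (X \<noteq> {})"
      proof (cases "us = []")
        case True
        then show ?thesis using su \<open>m < l\<close> by auto
      next
        case False
        then show ?thesis using su sub[OF X] last_in_set[OF False] by auto
      qed
      moreover have "(m < hd (ws @ [r])) = (X = B)"
      proof (cases "ws = []")
        case True
        then show ?thesis using sw X \<open>m < r\<close> by auto
      next
        case False
        then have "hd ws \<in> B - X" using sw hd_in_set by blast
        then have "\<not> m < hd ws" "X \<noteq> B" using lt_m by (blast dest: order.asym)+
        then show ?thesis using False by simp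
      qed
      ultimately show ?thesis
        unfolding word_weight_append by (simp add: mult_ac)
    qed
    have "(\<Sum>xs\<in>permutations_of_set A. word_weight g l xs r) =
        (\<Sum>X\<in>Pow B. \<Sum>us\<in>permutations_of_set X. \<Sum>ws\<in>permutations_of_set (B - X).
           g (X \<noteq> {}) (X = B) * (word_weight g l us m * word_weight g m ws r))"
      unfolding sum_permutations_of_set_split[OF less.prems(1) m] B_def[symmetric]
      by (intro sum.cong refl middle) auto
    also have "\<dots> = (\<Sum>X\<in>Pow B. g (X \<noteq> {}) (X = B) * (f (card X) * f (card (B - X))))"
    proof (intro sum.cong refl)
      fix X assume "X \<in> Pow B"
      then have "(\<Sum>us\<in>permutations_of_set X. word_weight g l us m) = f (card X)"
        "(\<Sum>ws\<in>permutations_of_set (B - X). word_weight g m ws r) = f (card (B - X))"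
        by (auto intro!: IH)
      then show "(\<Sum>us\<in>permutations_of_set X. \<Sum>ws\<in>permutations_of_set (B - X).
           g (X \<noteq> {}) (X = B) * (word_weight g l us m * word_weight g m ws r)) =
          g (X \<noteq> {}) (X = B) * (f (card X) * f (card (B - X)))"
        by (simp add: sum_distrib_left[symmetric] sum_distrib_right[symmetric])
    qed
    also have "\<dots> = (\<Sum>X\<in>Pow B. f (card X) * g (card X \<noteq> 0) (card X = card B) * f (card B - card X))"
    proof (intro sum.cong refl)
      fix X assume X: "X \<in> Pow B"
      then have "finite X" using B(1) finite_subset by auto
      then have "X \<noteq> {} \<longleftrightarrow> card X \<noteq> 0" "X = B \<longleftrightarrow> card X = card B"
        "card (B - X) = card B - card X"
        using X B(1) card_subset_eq[OF B(1)] by (auto simp: card_Diff_subset)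
      then show "g (X \<noteq> {}) (X = B) * (f (card X) * f (card (B - X))) =
          f (card X) * g (card X \<noteq> 0) (card X = card B) * f (card B - card X)"
        by (simp add: mult_ac)
    qed
    also have "\<dots> = f (card A)"
      unfolding B(2) f_Suc by (rule sum_Pow_card[OF B(1)])
    finally show ?thesis .
  qed
qed

section \<open>From permutations to power series coefficients\<close>

lemma sum_permutes_letters:
  "(\<Sum>s | s permutes {1..n}. h (map (letter n s) [1..<Suc n])) =
    (\<Sum>xs\<in>permutations_of_set (enat ` {1..n}). h xs)"
proof -
  let ?P = "{s. s permutes {1..n}}"
  let ?f = "\<lambda>s. map (letter n s) [1..<Suc n]"
  have map: "?f s = map (enat \<circ> s) [1..<Suc n]" for s
    by (rule map_cong) (auto simp: letter_def)
  have inj: "inj_on ?f ?P"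
  proof (rule inj_onI)
    fix s t assume s: "s \<in> ?P" and t: "t \<in> ?P" and eq: "?f s = ?f t"
    show "s = t"
    proof
      fix x
      show "s x = t x"
      proof (cases "x \<in> {1..n}")
        case True
        then show ?thesis using eq unfolding map by (auto simp: map_eq_conv)
      next
        case False
        then show ?thesis using s t by (simp add: permutes_not_in)
      qed
    qed
  qed
  have "?f ` ?P \<subseteq> permutations_of_set (enat ` {1..n})"
  proof safe
    fix s assume s: "s permutes {1..n}"
    have "set (?f s) = enat ` s ` {1..n}"
      unfolding map by (auto simp: image_comp atLeastLessThanSuc_atLeastAtMost simp del: upt_Suc)
    then have "set (?f s) = enat ` {1..n}" using permutes_image[OF s] by simp
    moreover have "distinct (?f s)"
      unfolding map using permutes_inj[OF s] by (auto simp: distinct_map inj_on_def simp del: upt_Suc)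
    ultimately show "?f s \<in> permutations_of_set (enat ` {1..n})"
      by (simp add: permutations_of_set_def)
  qed
  \<comment> \<open>Both sets have n! elements, so the injective image is everything.\<close>
  moreover have "card (?f ` ?P) = card (permutations_of_set (enat ` {1..n}))"
    unfolding card_image[OF inj]
    by (simp add: card_permutations[of "{1..n}" n, simplified] card_image inj_on_def)
  ultimately have "?f ` ?P = permutations_of_set (enat ` {1..n})"
    by (intro card_subset_eq) auto
  then show ?thesis
    using sum.reindex[OF inj, of h] by simp
qed

text \<open>The differential equation for \<open>Y\<close>, read coefficientwise, is the recurrence
  of \<open>sum_word_weight\<close>. Only the combinations b + c and a v of the letter weights enter
  it.\<close>

lemma sum_permutes_letter_weights:
  fixes g :: "bool \<Rightarrow> bool \<Rightarrow> 'a::real_field" and Y :: "real fps"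
  assumes Y_0: "Y $ 0 = 0"
    and ode: "fps_deriv Y = 1 + fps_const \<beta> * Y + fps_const \<kappa> * Y\<^sup>2"
    and \<beta>: "g True True + g False False = of_real \<beta>"
    and \<kappa>: "g True False * g False True = of_real \<kappa>"
    and n: "n \<ge> 1"
  shows "(\<Sum>s | s permutes {1..n}. \<Prod>p=1..n.
      g (letter n s (p - 1) < letter n s p) (letter n s p < letter n s (p + 1))) =
    g False True * of_real (fact n * Y $ n)"
proof -
  define v where "v = g False True"
  \<comment> \<open>The empty word has weight 1 although \<open>Y $ 0 = 0\<close>; the exception at
    0 produces the linear term of the equation.\<close>
  define f where "f k = (if k = 0 then 1 else v * of_real (fact k * Y $ k))" for k
  have Y_Suc: "fact (Suc k) * Y $ Suc k =
      fact k * ((if k = 0 then 1 else 0) + \<beta> * Y $ k + \<kappa> * (\<Sum>i\<le>k. Y $ i * Y $ (k - i)))" for k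
  proof -
    have "(1 + of_nat k) * Y $ Suc k = fps_deriv Y $ k"
      by simp
    also have "\<dots> = (if k = 0 then 1 else 0) + \<beta> * Y $ k + \<kappa> * (\<Sum>i\<le>k. Y $ i * Y $ (k - i))"
      unfolding ode by (simp add: power2_eq_square fps_mult_nth[of Y Y] atLeast0AtMost)
    finally show ?thesis
      by (simp only: fact_Suc of_nat_Suc mult_ac)
  qed
  have f_Suc: "f (Suc k) = (\<Sum>i\<le>k. of_nat (k choose i) * (f i * g (i \<noteq> 0) (i = k) * f (k - i)))" for k
  proof (cases "k = 0")
    case True
    then show ?thesis using Y_Suc[of 0] by (simp add: f_def v_def Y_0)
  next
    case False
    have "of_nat (k choose i) * (f i * g (i \<noteq> 0) (i = k) * f (k - i)) =
        (if i = 0 then g False False * f k else 0) + (if i = k then g True True * f k else 0) +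
        v * of_real (fact k * (\<kappa> * (Y $ i * Y $ (k - i))))" if le: "i \<le> k" for i
    proof -
      \<comment> \<open>With an empty left block the maximum is a double descent, with an empty
        right block a double ascent, otherwise a peak. Since \<open>Y $ 0 = 0\<close>, the quadratic
        term vanishes in the first two cases.\<close>
      consider "i = 0" | "i = k" "i \<noteq> 0" | "i \<noteq> 0" "i < k" using le by linarith
      then show ?thesis
      proof cases
        case 3
        have "of_nat (k choose i) * (f i * g (i \<noteq> 0) (i = k) * f (k - i)) =
            v * (g True False * v) * of_real (of_nat (k choose i) * (fact i * fact (k - i)) * (Y $ i * Y $ (k - i)))"
          using 3 by (simp add: f_def mult_ac)
        also have "of_nat (k choose i) * (fact i * fact (k - i)) = (fact k :: real)"
          using binomial_fact_lemma[OF le] by (metis of_nat_fact of_nat_mult mult.commute)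
        also have "v * (g True False * v) = v * of_real \<kappa>"
          by (simp add: v_def flip: \<kappa>)
        finally show ?thesis using 3 by (simp add: mult_ac)
      qed (use False in \<open>simp_all add: f_def Y_0\<close>)
    qed
    then have "(\<Sum>i\<le>k. of_nat (k choose i) * (f i * g (i \<noteq> 0) (i = k) * f (k - i))) =
        (g True True + g False False) * f k +
        v * of_real (fact k * (\<kappa> * (\<Sum>i\<le>k. Y $ i * Y $ (k - i))))"
      by (simp add: sum.distrib sum_distrib_left algebra_simps)
    also have "\<dots> = v * of_real (fact (Suc k) * Y $ Suc k)"
      unfolding Y_Suc \<beta> using False by (simp add: f_def algebra_simps)
    finally show ?thesis by (simp only: f_def nat.distinct if_False)
  qed
  have "(\<Prod>p=1..n. g (letter n s (p - 1) < letter n s p) (letter n s p < letter n s (p + 1))) =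
      word_weight g \<infinity> (map (letter n s) [1..<Suc n]) \<infinity>" for s
    using word_weight_map_upt[of 0 n g "letter n s"] by (simp add: letter_def del: upt_Suc)
  then have "(\<Sum>s | s permutes {1..n}. \<Prod>p=1..n.
      g (letter n s (p - 1) < letter n s p) (letter n s p < letter n s (p + 1))) =
      (\<Sum>xs\<in>permutations_of_set (enat ` {1..n}). word_weight g \<infinity> xs \<infinity>)"
    by (simp only: sum_permutes_letters[where h = "\<lambda>xs. word_weight g \<infinity> xs \<infinity>"])
  also have "\<dots> = f (card (enat ` {1..n}))"
    by (rule sum_word_weight[OF _ f_Suc]) (auto simp: f_def)
  also have "\<dots> = g False True * of_real (fact n * Y $ n)"
    using n by (simp add: card_image inj_on_def f_def v_def)
  finally show ?thesis .
qed

section \<open>The power series of tan and sec\<close>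

lemma fps_sec_times_cos: "inverse (fps_cos (1 :: real)) * fps_cos 1 = 1"
  by (rule inverse_mult_eq_1) (simp add: fps_cos_def)

lemma fps_tan_eq_sin_times_sec: "fps_tan (1 :: real) = fps_sin 1 * inverse (fps_cos 1)"
  unfolding fps_tan_def by (rule fps_divide_unit) (simp add: fps_cos_def)

lemma fps_sec_squared: "(inverse (fps_cos (1 :: real)))\<^sup>2 = 1 + (fps_tan 1)\<^sup>2"
proof -
  have "(inverse (fps_cos (1 :: real)))\<^sup>2 = (inverse (fps_cos 1))\<^sup>2 * ((fps_cos 1)\<^sup>2 + (fps_sin 1)\<^sup>2)"
    by (simp add: fps_sin_cos_sum_of_squares)
  also have "\<dots> = (inverse (fps_cos 1) * fps_cos 1)\<^sup>2 + (fps_tan 1)\<^sup>2"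
    by (simp add: fps_tan_eq_sin_times_sec power_mult_distrib algebra_simps)
  finally show ?thesis by (simp add: fps_sec_times_cos)
qed

lemma fps_deriv_sec:
  "fps_deriv (inverse (fps_cos (1 :: real))) = inverse (fps_cos 1) * fps_tan 1"
proof -
  have "fps_deriv (inverse (fps_cos (1 :: real))) = - fps_deriv (fps_cos 1) * (inverse (fps_cos 1))\<^sup>2"
    by (rule fps_inverse_deriv) (simp add: fps_cos_def)
  then show ?thesis
    by (simp add: fps_cos_deriv fps_tan_eq_sin_times_sec power2_eq_square mult_ac flip: fps_const_neg)
qed

lemma fps_deriv_tan: "fps_deriv (fps_tan (1 :: real)) = 1 + (fps_tan 1)\<^sup>2"
proof -
  have "fps_deriv (fps_tan (1 :: real)) =
      fps_cos 1 * inverse (fps_cos 1) + fps_sin 1 * (inverse (fps_cos 1) * fps_tan 1)"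
    unfolding fps_tan_eq_sin_times_sec
    by (simp add: fps_sin_deriv fps_deriv_sec fps_tan_eq_sin_times_sec)
  also have "\<dots> = inverse (fps_cos 1) * fps_cos 1 + (fps_sin 1 * inverse (fps_cos 1)) * fps_tan 1"
    by (simp only: mult_ac)
  finally show ?thesis
    by (simp add: fps_sec_times_cos power2_eq_square flip: fps_tan_eq_sin_times_sec)
qed

lemma fps_tan_nth_0: "fps_tan (1 :: real) $ 0 = 0"
  by (simp add: fps_tan_eq_sin_times_sec fps_sin_def)

lemma fps_sec_nth_0: "inverse (fps_cos (1 :: real)) $ 0 = 1"
  by (simp add: fps_cos_def)

text \<open>Compare coefficients of T' = 1 + T^2 in odd degree \<open>m\<close>: in each product of
  coefficients with indices \<open>i\<close> and \<open>m - i\<close> one index is even, so the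
  product vanishes by induction.\<close>

lemma fps_tan_nth_even:
  assumes "even n"
  shows "fps_tan (1 :: real) $ n = 0"
  using assms
proof (induction n rule: less_induct)
  case (less n)
  show ?case
  proof (cases n)
    case 0
    then show ?thesis by (simp add: fps_tan_nth_0)
  next
    case (Suc m)
    then have "odd m" using less.prems by simp
    have "fps_tan (1 :: real) $ i * fps_tan 1 $ (m - i) = 0" if "i \<le> m" for i
      using less.IH[of i] less.IH[of "m - i"] that Suc \<open>odd m\<close> by (cases "even i") auto
    then have "(\<Sum>i=0..m. fps_tan (1 :: real) $ i * fps_tan 1 $ (m - i)) = 0"
      by (intro sum.neutral) auto
    moreover have "m \<noteq> 0" using \<open>odd m\<close> by (auto elim: oddE)
    ultimately have "(1 + of_nat m) * fps_tan (1 :: real) $ Suc m = 0"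
      using arg_cong[OF fps_deriv_tan, of "\<lambda>F. F $ m"]
      by (simp add: power2_eq_square fps_mult_nth)
    then show ?thesis unfolding Suc by (simp add: add_nonneg_eq_0_iff)
  qed
qed

text \<open>Compare coefficients of S' = S T in even degree \<open>m\<close>: for odd
  \<open>i\<close> the coefficient of S vanishes by induction, for even \<open>i\<close> that of T
  vanishes because \<open>m - i\<close> is even.\<close>

lemma fps_sec_nth_odd:
  assumes "odd n"
  shows "inverse (fps_cos (1 :: real)) $ n = 0"
  using assms
proof (induction n rule: less_induct)
  case (less n)
  then obtain m where m: "n = Suc m" "even m" by (cases n) auto
  have "inverse (fps_cos (1 :: real)) $ i * fps_tan 1 $ (m - i) = 0" if "i \<le> m" for i
    using less.IH[of i] fps_tan_nth_even[of "m - i"] that m by (cases "even i") auto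
  then have "(\<Sum>i=0..m. inverse (fps_cos (1 :: real)) $ i * fps_tan 1 $ (m - i)) = 0"
    by (intro sum.neutral) auto
  then have "(1 + of_nat m) * inverse (fps_cos (1 :: real)) $ Suc m = 0"
    using arg_cong[OF fps_deriv_sec, of "\<lambda>F. F $ m"]
    by (simp add: fps_mult_nth)
  then show ?case unfolding m(1) by (simp add: add_nonneg_eq_0_iff)
qed

lemma fps_deriv_tan_plus_sec:
  defines "Y \<equiv> fps_tan (1 :: real) + inverse (fps_cos 1) - 1"
  shows "fps_deriv Y = 1 + fps_const 1 * Y + fps_const (1 / 2) * Y\<^sup>2"
proof -
  define T S where "T = fps_tan (1 :: real)" and "S = inverse (fps_cos (1 :: real))"
  have S2: "S\<^sup>2 = 1 + T\<^sup>2" unfolding S_def T_def by (rule fps_sec_squared)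
  \<comment> \<open>By S^2 = 1 + T^2, both sides equal 1 + (T + S)^2, and T + S = 1 + Y.\<close>
  have "2 * fps_deriv Y = 2 * (1 + T\<^sup>2 + S * T)"
    by (simp add: Y_def T_def S_def fps_deriv_tan fps_deriv_sec)
  also have "\<dots> = 2 + 2 * Y + Y\<^sup>2"
    using S2 unfolding Y_def T_def[symmetric] S_def[symmetric] by algebra
  finally have "fps_const (1 / 2) * (fps_const 2 * fps_deriv Y) =
      fps_const (1 / 2) * (fps_const 2 + fps_const 2 * Y + Y\<^sup>2)"
    by (simp add: numeral_fps_const)
  then show ?thesis
    by (simp add: distrib_left mult.assoc[symmetric])
qed

section \<open>Letter types read off at positions\<close>

lemma letter_inj:
  assumes "s permutes {1..n}" "p \<in> {1..n}" "q \<noteq> p"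
  shows "letter n s q \<noteq> letter n s p"
  using assms permutes_inj[OF assms(1)] by (auto simp: letter_def inj_eq)

text \<open>Neighbouring letters never tie, so the descent to the right is the negation of the flag
  used by \<open>word_weight\<close>.\<close>

lemma is_peak_permutes:
  assumes "s permutes {1..n}" "p \<in> {1..n}"
  shows "is_peak n s (s p) \<longleftrightarrow>
    letter n s (p - 1) < letter n s p \<and> \<not> letter n s p < letter n s (p + 1)"
proof -
  have "letter n s (p + 1) \<noteq> letter n s p"
    by (rule letter_inj[OF assms]) simp
  then show ?thesis
    using assms(2) permutes_inj[OF assms(1)] by (auto simp: is_peak_def inj_eq)
qed

lemma is_double_ascent_permutes:
  assumes "s permutes {1..n}" "p \<in> {1..n}"
  shows "is_double_ascent n s (s p) \<longleftrightarrow>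
    letter n s (p - 1) < letter n s p \<and> letter n s p < letter n s (p + 1)"
  using assms(2) permutes_inj[OF assms(1)] by (auto simp: is_double_ascent_def inj_eq)

lemma one_le_letter:
  assumes "s permutes {1..n}"
  shows "1 \<le> letter n s p"
  using permutes_in_image[OF assms, of p] by (auto simp: letter_def one_enat_def)

lemma one_not_peak_nor_double_ascent:
  assumes "s permutes {1..n}"
  shows "\<not> is_peak n s 1" "\<not> is_double_ascent n s 1"
proof -
  have "\<not> letter n s q < letter n s p" if "p \<in> {1..n}" "s p = 1" for p q
    using one_le_letter[OF assms, of q] that by (simp add: letter_def one_enat_def not_less)
  then show "\<not> is_peak n s 1" "\<not> is_double_ascent n s 1"
    by (auto simp: is_peak_def is_double_ascent_def)
qed

text \<open>The factor \<open>h False False\<close> belongs to the letter 1.\<close>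

lemma prod_letters_eq_prod_positions:
  fixes h :: "bool \<Rightarrow> bool \<Rightarrow> 'a::comm_monoid_mult"
  assumes s: "s permutes {1..n}" and n: "n \<ge> 1"
    and g: "\<And>x y. g x y = h (x \<and> y) (x \<and> \<not> y)"
  shows "h False False * (\<Prod>j=2..n. h (is_double_ascent n s j) (is_peak n s j)) =
    (\<Prod>p=1..n. g (letter n s (p - 1) < letter n s p) (letter n s p < letter n s (p + 1)))"
proof -
  have "{1..n} = insert 1 {2..n}" using n by auto
  then have "h False False * (\<Prod>j=2..n. h (is_double_ascent n s j) (is_peak n s j)) =
      (\<Prod>j\<in>{1..n}. h (is_double_ascent n s j) (is_peak n s j))"
    by (simp add: one_not_peak_nor_double_ascent[OF s, simplified])
  \<comment> \<open>Reindexing along the bijection \<open>s\<close> passes from letters to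
    positions.\<close>
  also have "\<dots> = (\<Prod>p\<in>{1..n}. h (is_double_ascent n s (s p)) (is_peak n s (s p)))"
    using prod.permute[OF s, of "\<lambda>j. h (is_double_ascent n s j) (is_peak n s j)"] by (simp add: o_def)
  also have "\<dots> = (\<Prod>p=1..n. g (letter n s (p - 1) < letter n s p) (letter n s p < letter n s (p + 1)))"
    by (intro prod.cong refl) (simp only: is_peak_permutes[OF s] is_double_ascent_permutes[OF s] g)
  finally show ?thesis .
qed

text \<open>The flags of \<open>h\<close> do not separate valleys from double descents, so
  \<open>h False False\<close> is both v and c. As the weight of the letter 1, it is cancelled at
  the end.\<close>

lemma sum_permutes_letter_types:
  fixes h :: "bool \<Rightarrow> bool \<Rightarrow> 'a::real_field" and Y :: "real fps"
  assumes "Y $ 0 = 0"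
    and "fps_deriv Y = 1 + fps_const \<beta> * Y + fps_const \<kappa> * Y\<^sup>2"
    and "h True False + h False False = of_real \<beta>"
    and "h False True * h False False = of_real \<kappa>"
    and nz: "h False False \<noteq> 0"
    and "n \<ge> 1"
  shows "(\<Sum>s | s permutes {1..n}. \<Prod>j=2..n. h (is_double_ascent n s j) (is_peak n s j)) =
    of_real (fact n * Y $ n)"
proof -
  define g where "g x y = h (x \<and> y) (x \<and> \<not> y)" for x y
  have "h False False * (\<Sum>s | s permutes {1..n}. \<Prod>j=2..n. h (is_double_ascent n s j) (is_peak n s j)) =
      (\<Sum>s | s permutes {1..n}. \<Prod>p=1..n.
        g (letter n s (p - 1) < letter n s p) (letter n s p < letter n s (p + 1)))"
    unfolding sum_distrib_left
    by (rule sum.cong[OF refl], rule prod_letters_eq_prod_positions) (use assms(6) in \<open>auto simp: g_def\<close>)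
  also have "\<dots> = g False True * of_real (fact n * Y $ n)"
    by (rule sum_permutes_letter_weights) (use assms in \<open>simp_all add: g_def\<close>)
  finally show ?thesis using nz by (simp add: g_def)
qed

text \<open>Each position carries the factor of the step to its right. Position \<open>n\<close> is
  followed by infinity, an ascent, which accounts for the extra factor on the left.\<close>

lemma W4_eq_prod_positions:
  assumes s: "s permutes {1..n}" and n: "n \<ge> 1"
  defines "g \<equiv> \<lambda>x y. if y then (1 + \<i>) / 2 else (1 - \<i>) / 2"
  shows "(1 + \<i>) / 2 * W4 n s =
    (\<Prod>p=1..n. g (letter n s (p - 1) < letter n s p) (letter n s p < letter n s (p + 1)))"
proof -
  have ascent: "((1 + \<i>) / 2) ^ chi (s p < s (p + 1)) * ((1 - \<i>) / 2) ^ chi (s p > s (p + 1)) =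
      g (letter n s (p - 1) < letter n s p) (letter n s p < letter n s (p + 1))"
    if "p \<in> {1..<n}" for p
  proof -
    have "s p \<noteq> s (p + 1)" using permutes_inj[OF s] by (simp add: inj_eq)
    then show ?thesis using that by (auto simp: g_def letter_def chi_def)
  qed
  have "{1..n} = insert n {1..<n}" using n by auto
  then have "(\<Prod>p=1..n. g (letter n s (p - 1) < letter n s p) (letter n s p < letter n s (p + 1))) =
      (1 + \<i>) / 2 * (\<Prod>p=1..<n. g (letter n s (p - 1) < letter n s p) (letter n s p < letter n s (p + 1)))"
    using n by (simp add: g_def letter_def)
  also have "\<dots> = (1 + \<i>) / 2 * W4 n s"
    unfolding W4_def by (simp only: ascent cong: prod.cong)
  finally show ?thesis by simp
qed

section \<open>Evaluation of the four sums\<close>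

theorem theorem3p2:
  fixes n :: nat
  assumes "n \<ge> 1"
  shows "(\<Sum>s | s permutes {1..n}. W2 n s) = euler_number n \<and>
         (\<Sum>s | s permutes {1..n}. W3 n s) = euler_number n \<and>
         (\<Sum>s | s permutes {1..n}. W4 n s) = complex_of_real (euler_number n) \<and>
         (\<Sum>s | s permutes {1..n}. W1 n s) = (if odd n then euler_number n else 0)"
proof (intro conjI)
  define Y where "Y = fps_tan (1 :: real) + inverse (fps_cos 1) - 1"
  have Y_0: "Y $ 0 = 0"
    by (simp add: Y_def fps_tan_nth_0 fps_sec_nth_0)
  have ode: "fps_deriv Y = 1 + fps_const 1 * Y + fps_const (1 / 2) * Y\<^sup>2"
    unfolding Y_def by (rule fps_deriv_tan_plus_sec)
  \<comment> \<open>Subtracting 1 changes only the constant coefficient, and \<open>n\<close> is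
    positive.\<close>
  have euler: "euler_number n = fact n * Y $ n"
    using assms by (simp add: euler_number_def Y_def)
  \<comment> \<open>Here b = 0, c = v = 1 and a = 1/2, so b + c = 1 and a v = 1/2.\<close>
  show "(\<Sum>s | s permutes {1..n}. W2 n s) = euler_number n"
    using sum_permutes_letter_types[OF Y_0 ode, of "\<lambda>a p. 0 ^ chi a * (1 / 2) ^ chi p :: real" n] assms
    by (simp add: W2_def euler chi_def)
  \<comment> \<open>Here b = c = v = 1/2 and a = 1, which gives the same two constants.\<close>
  show "(\<Sum>s | s permutes {1..n}. W3 n s) = euler_number n"
    using sum_permutes_letter_types[OF Y_0 ode, of "\<lambda>a p. (1 / 2) ^ chi (\<not> p) :: real" n] assms
    by (simp add: W3_def euler chi_def)
  have A: "(1 + \<i>) / 2 \<noteq> 0" by (simp add: complex_eq_iff)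
  let ?g = "\<lambda>x y. if y then (1 + \<i>) / 2 else (1 - \<i>) / 2"
  have "(1 + \<i>) / 2 * (\<Sum>s | s permutes {1..n}. W4 n s) =
      (\<Sum>s | s permutes {1..n}. \<Prod>p=1..n.
        ?g (letter n s (p - 1) < letter n s p) (letter n s p < letter n s (p + 1)))"
    unfolding sum_distrib_left
    by (rule sum.cong[OF refl], rule W4_eq_prod_positions) (use assms in auto)
  \<comment> \<open>Again b + c = 1, and a v = (1 - i)(1 + i) / 4 = 1/2.\<close>
  also have "\<dots> = (if True then (1 + \<i>) / 2 else (1 - \<i>) / 2) * of_real (fact n * Y $ n)"
    by (rule sum_permutes_letter_weights[OF Y_0 ode]) (use assms in \<open>auto simp: complex_eq_iff\<close>)
  finally show "(\<Sum>s | s permutes {1..n}. W4 n s) = complex_of_real (euler_number n)"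
    using A unfolding euler by (simp only: if_True mult_cancel_left) blast
  \<comment> \<open>Here b = -1 and a = c = v = 1, so the linear term disappears and
    \<open>Y\<close> is tan.\<close>
  have "(\<Sum>s | s permutes {1..n}. W1 n s) = fact n * fps_tan 1 $ n"
    using sum_permutes_letter_types[OF fps_tan_nth_0, of 0 1 "\<lambda>a p. (- 1) ^ chi a :: real" n] assms
    by (simp add: W1_def chi_def fps_deriv_tan)
  then show "(\<Sum>s | s permutes {1..n}. W1 n s) = (if odd n then euler_number n else 0)"
    by (simp add: euler_number_def fps_tan_nth_even fps_sec_nth_odd)
qed

end
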